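(* Let $X$ be a set of $v$ points partitioned into four parts $X_0,X_1,X_2,X_3$ whose sizes $v_i=|X_i|$ pairwise differ by at most one, and let $h$ be a positive integer. For $0\le i\le 3$ and $1\le j\le h$ let $(X_i,\mathcal{A}_{i,j})$ be a $(v_i,3,2)$ covering design and $(X_i,\mathcal{B}_{i,j})$ a $(v_i,2,1)$ covering design, such that for each $i$, $\bigcup_{j=1}^h\mathcal{A}_{i,j}$ is the set of all $3$-subsets of $X_i$ and $\bigcup_{j=1}^h\mathcal{B}_{i,j}$ is the set of all $2$-subsets of $X_i$. For $i=0,1$ let $(X_i,\mathcal{D}_i)$ be a $(v_i,5,4,5)$ cover, and for $i=2,3$ let $(X_i,\mathcal{E}_i)$ be a $(v_i,5,4)$ covering design. Define $$\mathcal{C}=\bigcup_{i=0}^{1}\left(\mathcal{D}_i\cup\mathcal{E}_{i+2}\right)\cup\bigcup_{i=0}^{3}\bigcup_{j=1}^{h}\mathcal{A}_{i,j}\mathcal{B}_{(i+1)\bmod 4,\,j}\cup\bigcup_{i=0}^{1}\bigcup_{j=1}^{h}\mathcal{A}_{i,j}\mathcal{B}_{i+2,\,j}.$$ Then $(X,\mathcal{C})$ is a $(v,5,4,6)$ cover.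
   Context: A $(v,k,t,m)$ cover is a pair $(X,\mathcal{B})$ with $|X|=v$ and $\mathcal{B}$ a collection of $k$-subsets of $X$ such that every $m$-subset of $X$ meets some block in at least $t$ points; a $(v,k,t)$ covering design is a $(v,k,t,t)$ cover (every $t$-subset lies in some block). For collections $\mathcal{A},\mathcal{B}$, $\mathcal{A}\mathcal{B}=\{A\cup B: A\in\mathcal{A},B\in\mathcal{B}\}$. *)

theory Defs
  imports Main "HOL-Library.Disjoint_Sets"
begin

text \<open>
  The argument order follows the usual notation: a \<open>(v, k, t, m)\<close> cover \<open>(X, \<B>)\<close>.
  Finiteness of \<open>X\<close> is explicit because \<^const>\<open>card\<close> is \<open>0\<close> on infinite sets.
  No relation between the parameters is imposed; if \<open>v < m\<close> the covering condition is vacuous.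
\<close>

definition is_cover :: "nat \<Rightarrow> nat \<Rightarrow> nat \<Rightarrow> nat \<Rightarrow> 'a set \<Rightarrow> 'a set set \<Rightarrow> bool" where
  "is_cover v k t m X \<B> \<longleftrightarrow>
     finite X \<and> card X = v \<and>
     (\<forall>b\<in>\<B>. b \<subseteq> X \<and> card b = k) \<and>
     (\<forall>M. M \<subseteq> X \<and> card M = m \<longrightarrow> (\<exists>b\<in>\<B>. t \<le> card (M \<inter> b)))"

definition covering_design :: "nat \<Rightarrow> nat \<Rightarrow> nat \<Rightarrow> 'a set \<Rightarrow> 'a set set \<Rightarrow> bool" where
  "covering_design v k t X \<B> \<longleftrightarrow> is_cover v k t t X \<B>"

definition block_product :: "'a set set \<Rightarrow> 'a set set \<Rightarrow> 'a set set" where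
  "block_product \<A> \<B> = {a \<union> b |a b. a \<in> \<A> \<and> b \<in> \<B>}"

end

theory Submission
  imports Defs
begin

text \<open>
  The products \<open>\<A>\<^bsub>i,j\<^esub>\<B>\<^bsub>k,j\<^esub>\<close> occur for the arcs \<open>i \<rightarrow> k\<close> of a tournament on the four parts in which
  \<open>0\<close> and \<open>1\<close> have out-degree two and \<open>2\<close> and \<open>3\<close> have out-degree one. An arc \<open>i \<rightarrow> k\<close> settles
  every \<open>M\<close> with at least \<open>(3,1)\<close> or at least \<open>(2,2)\<close> points in \<open>(X\<^sub>i, X\<^sub>k)\<close>: one of the two subsets
  fixes the index \<open>j\<close>, and the design with that index on the other part covers the rest. As any
  two parts are joined by an arc, a \<open>6\<close>-set not yet settled has two or more points in only one
  part, hence at least three there and at most one in each other part. Three points leave one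
  point in every other part, so some out-neighbour is hit. Four points in \<open>X\<^sub>0\<close> or \<open>X\<^sub>1\<close> leave only
  one part missed, so one of the two out-neighbours is hit. The remaining cases are what \<open>\<D>\<^sub>i\<close>
  and \<open>\<E>\<^sub>i\<close> handle.
\<close>

text \<open>Lets \<open>M\<close> be any set reaching beyond \<open>X\<close>: the cover property is
  applied to an \<open>m\<close>-subset of \<open>M \<inter> X\<close>, and enlarging that subset to
  \<open>M\<close> only enlarges its intersection with the block.\<close>

lemma is_cover_meets:
  assumes "is_cover v k t m X \<B>" and "m \<le> card (M \<inter> X)"
  shows "\<exists>b\<in>\<B>. t \<le> card (M \<inter> b)"
proof -
  have fin: "finite X" and blocks: "\<And>b. b \<in> \<B> \<Longrightarrow> b \<subseteq> X"
    and cov: "\<And>T. T \<subseteq> X \<Longrightarrow> card T = m \<Longrightarrow> \<exists>b\<in>\<B>. t \<le> card (T \<inter> b)"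
    using assms(1) unfolding is_cover_def by auto
  obtain T where T: "T \<subseteq> M \<inter> X" "card T = m"
    using obtain_subset_with_card_n[OF assms(2)] by blast
  then obtain b where b: "b \<in> \<B>" "t \<le> card (T \<inter> b)"
    using cov[of T] by blast
  have "finite b"
    using blocks[OF b(1)] fin finite_subset by blast
  then have "card (T \<inter> b) \<le> card (M \<inter> b)"
    using T(1) by (intro card_mono) auto
  then show ?thesis
    using b by (meson le_trans)
qed

lemma block_product_meets:
  assumes "a \<in> \<A>" "b \<in> \<B>" "a \<inter> b = {}" "finite M"
    and "s \<le> card (M \<inter> a)" "t \<le> card (M \<inter> b)"
  shows "\<exists>c\<in>block_product \<A> \<B>. s + t \<le> card (M \<inter> c)"
proof
  show "a \<union> b \<in> block_product \<A> \<B>"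
    using assms(1,2) unfolding block_product_def by blast
  have "card (M \<inter> (a \<union> b)) = card (M \<inter> a) + card (M \<inter> b)"
    unfolding Int_Un_distrib using assms(3,4) by (intro card_Un_disjoint) auto
  then show "s + t \<le> card (M \<inter> (a \<union> b))"
    using assms(5,6) by simp
qed

lemma block_product_blocks:
  assumes "is_cover p k s m P \<A>" "is_cover q l t n Q \<B>" "P \<inter> Q = {}"
    and "c \<in> block_product \<A> \<B>"
  shows "c \<subseteq> P \<union> Q \<and> card c = k + l"
proof -
  have A: "\<And>a. a \<in> \<A> \<Longrightarrow> a \<subseteq> P \<and> card a = k" and B: "\<And>b. b \<in> \<B> \<Longrightarrow> b \<subseteq> Q \<and> card b = l"
    and fin: "finite P" "finite Q"
    using assms(1,2) unfolding is_cover_def by simp_all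
  obtain a b where c: "c = a \<union> b" and "a \<in> \<A>" "b \<in> \<B>"
    using assms(4) unfolding block_product_def by auto
  then have a: "a \<subseteq> P" "card a = k" and b: "b \<subseteq> Q" "card b = l"
    using A B by simp_all
  have "finite a" "finite b"
    using a(1) b(1) fin by (simp_all add: finite_subset)
  moreover have "a \<inter> b = {}"
    using a(1) b(1) assms(3) by blast
  ultimately have "card c = k + l"
    using a(2) b(2) c by (simp add: card_Un_disjoint)
  then show ?thesis
    using a(1) b(1) c by blast
qed

text \<open>The index \<open>j\<close> has to serve both factors. The family whose union is
  exhaustive supplies a full block inside \<open>M\<close> and thereby dictates \<open>j\<close>;
  the other factor then uses only that its design with this same \<open>j\<close> is a covering
  design.\<close>

lemma designs_product_meets:
  assumes A: "\<And>j. j \<in> J \<Longrightarrow> covering_design p (Suc s) s P (\<A> j)"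
    and B: "\<And>j. j \<in> J \<Longrightarrow> covering_design q (Suc t) t Q (\<B> j)"
    and A_all: "(\<Union>j\<in>J. \<A> j) = {S. S \<subseteq> P \<and> card S = Suc s}"
    and B_all: "(\<Union>j\<in>J. \<B> j) = {S. S \<subseteq> Q \<and> card S = Suc t}"
    and disj: "P \<inter> Q = {}" and M: "finite M"
    and meets: "Suc s \<le> card (M \<inter> P) \<and> t \<le> card (M \<inter> Q) \<or>
                s \<le> card (M \<inter> P) \<and> Suc t \<le> card (M \<inter> Q)"
  shows "\<exists>j\<in>J. \<exists>c\<in>block_product (\<A> j) (\<B> j). Suc (s + t) \<le> card (M \<inter> c)"
proof -
  \<comment> \<open>The two union equations place every block inside \<open>P\<close> or
    \<open>Q\<close>, so disjointness of the parts carries over to blocks.\<close>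
  have ab_disj: "a \<inter> b = {}" if "j \<in> J" "a \<in> \<A> j" "b \<in> \<B> j" for j a b
    using that A_all B_all disj by blast
  from meets show ?thesis
  proof (elim disjE conjE)
    assume P: "Suc s \<le> card (M \<inter> P)" and Q: "t \<le> card (M \<inter> Q)"
    obtain a where a: "a \<subseteq> M \<inter> P" "card a = Suc s"
      using obtain_subset_with_card_n[OF P] by blast
    then have "a \<in> (\<Union>j\<in>J. \<A> j)"
      unfolding A_all by blast
    then obtain j where j: "j \<in> J" "a \<in> \<A> j"
      by blast
    obtain b where b: "b \<in> \<B> j" "t \<le> card (M \<inter> b)"
      using is_cover_meets[OF _ Q] B[OF j(1)] unfolding covering_design_def by blast
    have "M \<inter> a = a"
      using a(1) by blast
    then show ?thesis
      using block_product_meets[OF j(2) b(1) ab_disj[OF j b(1)] M _ b(2), of "Suc s"] a(2) j(1)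
      by auto
  next
    assume P: "s \<le> card (M \<inter> P)" and Q: "Suc t \<le> card (M \<inter> Q)"
    obtain b where b: "b \<subseteq> M \<inter> Q" "card b = Suc t"
      using obtain_subset_with_card_n[OF Q] by blast
    then have "b \<in> (\<Union>j\<in>J. \<B> j)"
      unfolding B_all by blast
    then obtain j where j: "j \<in> J" "b \<in> \<B> j"
      by blast
    obtain a where a: "a \<in> \<A> j" "s \<le> card (M \<inter> a)"
      using is_cover_meets[OF _ P] A[OF j(1)] unfolding covering_design_def by blast
    have "M \<inter> b = b"
      using b(1) by blast
    then show ?thesis
      using block_product_meets[OF a(1) j(2) ab_disj[OF j(1) a(1) j(2)] M a(2), of "Suc t"] b(2) j(1)
      by auto
  qed
qed

theorem theorem20:
  fixes X :: "'a set"
    and Xs :: "nat \<Rightarrow> 'a set"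
    and v h :: nat
    and vs :: "nat \<Rightarrow> nat"
    and \<A> \<B> :: "nat \<Rightarrow> nat \<Rightarrow> 'a set set"
    and \<D> \<E> :: "nat \<Rightarrow> 'a set set"
    and \<C> :: "'a set set"
  assumes "finite X" and "card X = v"
    and "X = (\<Union>i\<in>{0..3}. Xs i)" and "disjoint_family_on Xs {0..3}"
    and "\<And>i. i \<in> {0..3} \<Longrightarrow> vs i = card (Xs i)"
    and "\<And>i j. i \<in> {0..3} \<Longrightarrow> j \<in> {0..3} \<Longrightarrow> \<bar>int (vs i) - int (vs j)\<bar> \<le> 1"
    and "h > 0"
    and "\<And>i j. i \<in> {0..3} \<Longrightarrow> j \<in> {1..h} \<Longrightarrow> covering_design (vs i) 3 2 (Xs i) (\<A> i j)"
    and "\<And>i j. i \<in> {0..3} \<Longrightarrow> j \<in> {1..h} \<Longrightarrow> covering_design (vs i) 2 1 (Xs i) (\<B> i j)"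
    and "\<And>i. i \<in> {0..3} \<Longrightarrow> (\<Union>j\<in>{1..h}. \<A> i j) = {S. S \<subseteq> Xs i \<and> card S = 3}"
    and "\<And>i. i \<in> {0..3} \<Longrightarrow> (\<Union>j\<in>{1..h}. \<B> i j) = {S. S \<subseteq> Xs i \<and> card S = 2}"
    and "\<And>i. i \<in> {0, 1} \<Longrightarrow> is_cover (vs i) 5 4 5 (Xs i) (\<D> i)"
    and "\<And>i. i \<in> {2, 3} \<Longrightarrow> covering_design (vs i) 5 4 (Xs i) (\<E> i)"
    and "\<C> = (\<Union>i\<in>{0..1}. \<D> i \<union> \<E> (i + 2))
           \<union> (\<Union>i\<in>{0..3}. \<Union>j\<in>{1..h}. block_product (\<A> i j) (\<B> ((i + 1) mod 4) j))
           \<union> (\<Union>i\<in>{0..1}. \<Union>j\<in>{1..h}. block_product (\<A> i j) (\<B> (i + 2) j))"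
  shows "is_cover v 5 4 6 X \<C>"
proof -
  note disj = assms(4) and A = assms(8) and B = assms(9) and A_all = assms(10)
    and B_all = assms(11) and D = assms(12) and E = assms(13)
  \<comment> \<open>The first four pairs are \<open>(i, (i + 1) mod 4)\<close>, the last two
    \<open>(i, i + 2)\<close>. Each of the six pairs of parts occurs in exactly one
    direction.\<close>
  define arcs :: "(nat \<times> nat) set" where "arcs = {(0,1), (1,2), (2,3), (3,0), (0,2), (1,3)}"
  have four: "{0..3} = {0, 1, 2, 3 :: nat}" and two: "{0..1} = {0, 1 :: nat}"
    by auto
  have shift: "Suc (Suc 0) = 2" "Suc 2 = 3"
    by simp_all
  have C: "\<C> = (\<Union>i\<in>{0, 1}. \<D> i) \<union> (\<Union>i\<in>{2, 3}. \<E> i)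
      \<union> (\<Union>(i, k)\<in>arcs. \<Union>j\<in>{1..h}. block_product (\<A> i j) (\<B> k j))"
    unfolding assms(14) four two arcs_def by (simp add: shift) (simp only: Un_ac)
  have arc: "i \<in> {0..3}" "k \<in> {0..3}" "Xs i \<inter> Xs k = {}" if "(i, k) \<in> arcs" for i k
  proof -
    show i: "i \<in> {0..3}" and k: "k \<in> {0..3}"
      using that unfolding arcs_def by auto
    have "i \<noteq> k"
      using that unfolding arcs_def by auto
    then show "Xs i \<inter> Xs k = {}"
      using disjoint_family_onD[OF disj i k] by simp
  qed
  have Xs_sub: "Xs i \<subseteq> X" if "i \<in> {0..3}" for i
    using that assms(3) by blast
  have blocks: "c \<subseteq> X \<and> card c = 5" if c: "c \<in> \<C>" for c
  proof -
    consider (D) i where "i \<in> {0, 1}" "c \<in> \<D> i" | (E) i where "i \<in> {2, 3}" "c \<in> \<E> i"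
      | (prod) i k j where "(i, k) \<in> arcs" "j \<in> {1..h}" "c \<in> block_product (\<A> i j) (\<B> k j)"
      using c unfolding C by blast
    then show ?thesis
    proof cases
      case D
      then have "c \<subseteq> Xs i \<and> card c = 5" and "i \<in> {0..3}"
        using assms(12)[OF D(1)] unfolding is_cover_def by auto
      then show ?thesis
        using Xs_sub by blast
    next
      case E
      then have "c \<subseteq> Xs i \<and> card c = 5" and "i \<in> {0..3}"
        using assms(13)[OF E(1)] unfolding covering_design_def is_cover_def by auto
      then show ?thesis
        using Xs_sub by blast
    next
      case prod
      note ik = arc[OF prod(1)]
      \<comment> \<open>The sum stays unevaluated to match \<open>k + l\<close> in
        \<open>block_product_blocks\<close>.\<close>
      have "c \<subseteq> Xs i \<union> Xs k \<and> card c = 3 + 2"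
        using block_product_blocks[OF _ _ ik(3) prod(3)] A[OF ik(1) prod(2)] B[OF ik(2) prod(2)]
        unfolding covering_design_def by blast
      then show ?thesis
        using Xs_sub[OF ik(1)] Xs_sub[OF ik(2)] by auto
    qed
  qed
  have "\<exists>c\<in>\<C>. 4 \<le> card (M \<inter> c)" if M: "M \<subseteq> X" "card M = 6" for M
  proof (rule ccontr)
    assume no: "\<not> ?thesis"
    have finM: "finite M"
      using M(1) assms(1) finite_subset by blast
    define m where "m i = card (M \<inter> Xs i)" for i
    have "card M = card (\<Union>i\<in>{0..3}. M \<inter> Xs i)"
      using M(1) assms(3) by (intro arg_cong[of _ _ card]) blast
    also have "\<dots> = (\<Sum>i\<in>{0..3}. m i)"
      unfolding m_def using finM disj
      by (intro card_UN_disjoint) (auto simp: disjoint_family_on_def)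
    finally have total: "m 0 + m 1 + m 2 + m 3 = 6"
      using M(2) unfolding four by simp
    have D_bound: "m i < 5" if i: "i \<in> {0, 1}" for i
    proof (rule ccontr)
      assume "\<not> ?thesis"
      then obtain b where "b \<in> \<D> i" "4 \<le> card (M \<inter> b)"
        using is_cover_meets[OF D[OF i], of M] unfolding m_def by auto
      then show False
        using no i unfolding C by blast
    qed
    have E_bound: "m i < 4" if i: "i \<in> {2, 3}" for i
    proof (rule ccontr)
      assume "\<not> ?thesis"
      then obtain b where "b \<in> \<E> i" "4 \<le> card (M \<inter> b)"
        using is_cover_meets[OF E[OF i, unfolded covering_design_def], of M] unfolding m_def by auto
      then show False
        using no i unfolding C by blast
    qed
    have arc_bound: "\<not> (3 \<le> m i \<and> 1 \<le> m k \<or> 2 \<le> m i \<and> 2 \<le> m k)" if ik: "(i, k) \<in> arcs" for i k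
    proof
      assume "3 \<le> m i \<and> 1 \<le> m k \<or> 2 \<le> m i \<and> 2 \<le> m k"
      \<comment> \<open>Here \<open>s = 2\<close> and \<open>t = 1\<close>: the two alternatives
        become \<open>(3,1)\<close> and \<open>(2,2)\<close>, and both give
        \<open>Suc (2 + 1) = 4\<close> common points.\<close>
      then have "\<exists>j\<in>{1..h}. \<exists>c\<in>block_product (\<A> i j) (\<B> k j). Suc (2 + 1) \<le> card (M \<inter> c)"
        using A[OF arc(1)[OF ik]] B[OF arc(2)[OF ik]] A_all[OF arc(1)[OF ik]]
          B_all[OF arc(2)[OF ik]] arc(3)[OF ik] finM
        by (intro designs_product_meets[where P = "Xs i" and Q = "Xs k" and p = "vs i" and q = "vs k"])
          (simp_all add: m_def eval_nat_numeral)
      then obtain j c where "j \<in> {1..h}" "c \<in> block_product (\<A> i j) (\<B> k j)" "4 \<le> card (M \<inter> c)"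
        by auto
      then show False
        using no ik unfolding C by blast
    qed
    have heavy: "m k = 0" if "3 \<le> m i" "(i, k) \<in> arcs" for i k
      using arc_bound[OF that(2)] that(1) by linarith
    have pair: "m i \<le> 1 \<or> m k \<le> 1" if "(i, k) \<in> arcs" for i k
      using arc_bound[OF that] by linarith
    \<comment> \<open>All six pairs of parts are listed, so at most one \<open>m i\<close> exceeds
      1.\<close>
    have "m 0 \<le> 1 \<or> m 1 \<le> 1" "m 1 \<le> 1 \<or> m 2 \<le> 1" "m 2 \<le> 1 \<or> m 3 \<le> 1"
      "m 3 \<le> 1 \<or> m 0 \<le> 1" "m 0 \<le> 1 \<or> m 2 \<le> 1" "m 1 \<le> 1 \<or> m 3 \<le> 1"
      by (rule pair, simp add: arcs_def)+
    then consider (0) "m 1 \<le> 1" "m 2 \<le> 1" "m 3 \<le> 1" | (1) "m 0 \<le> 1" "m 2 \<le> 1" "m 3 \<le> 1"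
      | (2) "m 0 \<le> 1" "m 1 \<le> 1" "m 3 \<le> 1" | (3) "m 0 \<le> 1" "m 1 \<le> 1" "m 2 \<le> 1"
      by blast
    then show False
    proof cases
      \<comment> \<open>With both out-neighbours empty, only part 3 can contribute a further point,
        at most one. Hence \<open>m 0\<close> is at least 5, against the bound from
        \<open>\<D> 0\<close>.\<close>
      case 0
      then have "3 \<le> m 0"
        using total by linarith
      then have "m 1 = 0" "m 2 = 0"
        by (rule heavy, simp add: arcs_def)+
      then show False
        using 0 total D_bound[of 0] by simp
    next
      case 1
      then have "3 \<le> m 1"
        using total by linarith
      then have "m 2 = 0" "m 3 = 0"
        by (rule heavy, simp add: arcs_def)+
      then show False
        using 1 total D_bound[of 1] by simp
    next
      \<comment> \<open>Only one out-neighbour is forced to be empty; the other two parts contribute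
        at most one point each. Hence \<open>m 2\<close> is at least 4, which is why
        \<open>\<E> 2\<close> has to cover all 4-subsets.\<close>
      case 2
      then have "3 \<le> m 2"
        using total by linarith
      then have "m 3 = 0"
        by (rule heavy, simp add: arcs_def)+
      then show False
        using 2 total E_bound[of 2] by simp
    next
      case 3
      then have "3 \<le> m 3"
        using total by linarith
      then have "m 0 = 0"
        by (rule heavy, simp add: arcs_def)+
      then show False
        using 3 total E_bound[of 3] by simp
    qed
  qed
  then show ?thesis
    using assms(1,2) blocks unfolding is_cover_def by blast
qed

end
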